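(* Let $\mathscr A$ be a finitary exact category. Then the Hall algebra $H_{\mathscr A}$ is generated, as a unital $\mathbb Q$-algebra, by the isomorphism classes $[X]$ of indecomposable objects $X$ of $\mathscr A$.
   Context: All categories are essentially small; exact categories are in the sense of Quillen. $\mathrm{Iso}\,\mathscr A$ is the set of isomorphism classes $[X]$ of objects of $\mathscr A$. $\underline{\mathrm{Ext}}^1_{\mathscr A}(A,B)$ is the set of all $[X]\in\mathrm{Iso}\,\mathscr A$ such that there is a short exact sequence (conflation) $B\rightarrowtail X\twoheadrightarrow A$ in $\mathscr A$. $\mathscr A$ is Hom-finite if $\mathrm{Hom}_{\mathscr A}(X,Y)$ is finite for all $X,Y$; it is finitary if it is Hom-finite and $\underline{\mathrm{Ext}}^1_{\mathscr A}(A,B)$ is finite for all $A,B$. Let $\mathcal E(A,B)_X$ be the set of all short exact sequences $B\rightarrowtail X\twoheadrightarrow A$, i.e. of pairs $(f,g)$ of morphisms; the Hall number is $F_{A,B}^X=\#\mathcal E(A,B)_X/(\#\mathrm{Aut}_{\mathscr A}A\cdot\#\mathrm{Aut}_{\mathscr A}B)$. The Hall algebra $H_{\mathscr A}$ is the $\mathbb Q$-vector space with basis $\mathrm{Iso}\,\mathscr A$ and product $[A]\cdot[B]=\sum_{[C]}F_{A,B}^C[C]$; it is an associative algebra with unit $[0]$. *)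

theory Defs
  imports Complex_Main "HOL-Algebra.Group" "HOL-Library.Poly_Mapping"
begin

text \<open>
  Categories are small: objects and arrows form sets.  An arrow determines its source and target,
  and \<open>g \<cdot> f\<close> is only meaningful when \<open>tgt f = src g\<close>.
\<close>

record ('o, 'm) cat =
  Ob :: "'o set"
  Ar :: "'m set"
  src :: "'m \<Rightarrow> 'o"
  tgt :: "'m \<Rightarrow> 'o"
  ide :: "'o \<Rightarrow> 'm"
  cmp :: "'m \<Rightarrow> 'm \<Rightarrow> 'm"  (infixl \<open>\<cdot>\<index>\<close> 70)

definition Hom :: "('o, 'm, 'z) cat_scheme \<Rightarrow> 'o \<Rightarrow> 'o \<Rightarrow> 'm set" where
  "Hom \<A> X Y = {f \<in> Ar \<A>. src \<A> f = X \<and> tgt \<A> f = Y}"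

locale category =
  fixes \<A> (structure)
  assumes src_Ob: "f \<in> Ar \<A> \<Longrightarrow> src \<A> f \<in> Ob \<A>"
    and tgt_Ob: "f \<in> Ar \<A> \<Longrightarrow> tgt \<A> f \<in> Ob \<A>"
    and ide_Hom: "X \<in> Ob \<A> \<Longrightarrow> ide \<A> X \<in> Hom \<A> X X"
    and cmp_Hom: "f \<in> Hom \<A> X Y \<Longrightarrow> g \<in> Hom \<A> Y Z \<Longrightarrow> g \<cdot> f \<in> Hom \<A> X Z"
    and cmp_ide: "f \<in> Hom \<A> X Y \<Longrightarrow> f \<cdot> ide \<A> X = f"
    and ide_cmp: "f \<in> Hom \<A> X Y \<Longrightarrow> ide \<A> Y \<cdot> f = f"
    and cmp_assoc: "f \<in> Hom \<A> W X \<Longrightarrow> g \<in> Hom \<A> X Y \<Longrightarrow> h \<in> Hom \<A> Y Z \<Longrightarrow>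
      (h \<cdot> g) \<cdot> f = h \<cdot> (g \<cdot> f)"

definition Isos :: "('o, 'm, 'z) cat_scheme \<Rightarrow> 'o \<Rightarrow> 'o \<Rightarrow> 'm set" where
  "Isos \<A> X Y = {f \<in> Hom \<A> X Y. \<exists>g \<in> Hom \<A> Y X.
     g \<cdot>\<^bsub>\<A>\<^esub> f = ide \<A> X \<and> f \<cdot>\<^bsub>\<A>\<^esub> g = ide \<A> Y}"

definition Aut :: "('o, 'm, 'z) cat_scheme \<Rightarrow> 'o \<Rightarrow> 'm set" where
  "Aut \<A> X = Isos \<A> X X"

definition iso_class :: "('o, 'm, 'z) cat_scheme \<Rightarrow> 'o \<Rightarrow> 'o set" where
  "iso_class \<A> X = {Y \<in> Ob \<A>. Isos \<A> X Y \<noteq> {}}"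

definition iso_classes :: "('o, 'm, 'z) cat_scheme \<Rightarrow> 'o set set" where
  "iso_classes \<A> = iso_class \<A> ` Ob \<A>"

definition zero_object :: "('o, 'm, 'z) cat_scheme \<Rightarrow> 'o \<Rightarrow> bool" where
  "zero_object \<A> Z \<longleftrightarrow> Z \<in> Ob \<A> \<and>
     (\<forall>X \<in> Ob \<A>. (\<exists>!f. f \<in> Hom \<A> X Z) \<and> (\<exists>!f. f \<in> Hom \<A> Z X))"

definition is_pullback ::
  "('o, 'm, 'z) cat_scheme \<Rightarrow> 'm \<Rightarrow> 'm \<Rightarrow> 'm \<Rightarrow> 'm \<Rightarrow> bool" where
  \<comment> \<open>\<open>p\<close>, \<open>q\<close> with \<open>g \<cdot> p = h \<cdot> q\<close> is a pullback of the cospan \<open>g\<close>, \<open>h\<close>;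
      thus \<open>q\<close> is the base change of \<open>g\<close> along \<open>h\<close>\<close>
  "is_pullback \<A> g h p q \<longleftrightarrow>
     p \<in> Ar \<A> \<and> q \<in> Ar \<A> \<and> src \<A> p = src \<A> q \<and> tgt \<A> p = src \<A> g \<and> tgt \<A> q = src \<A> h \<and>
     g \<cdot>\<^bsub>\<A>\<^esub> p = h \<cdot>\<^bsub>\<A>\<^esub> q \<and>
     (\<forall>W \<in> Ob \<A>. \<forall>a \<in> Hom \<A> W (src \<A> g). \<forall>b \<in> Hom \<A> W (src \<A> h).
        g \<cdot>\<^bsub>\<A>\<^esub> a = h \<cdot>\<^bsub>\<A>\<^esub> b \<longrightarrow>
        (\<exists>!u. u \<in> Hom \<A> W (src \<A> p) \<and> p \<cdot>\<^bsub>\<A>\<^esub> u = a \<and> q \<cdot>\<^bsub>\<A>\<^esub> u = b))"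

definition is_pushout ::
  "('o, 'm, 'z) cat_scheme \<Rightarrow> 'm \<Rightarrow> 'm \<Rightarrow> 'm \<Rightarrow> 'm \<Rightarrow> bool" where
  \<comment> \<open>\<open>p\<close>, \<open>q\<close> with \<open>p \<cdot> f = q \<cdot> h\<close> is a pushout of the span \<open>f\<close>, \<open>h\<close>;
      thus \<open>q\<close> is the cobase change of \<open>f\<close> along \<open>h\<close>\<close>
  "is_pushout \<A> f h p q \<longleftrightarrow>
     p \<in> Ar \<A> \<and> q \<in> Ar \<A> \<and> tgt \<A> p = tgt \<A> q \<and> src \<A> p = tgt \<A> f \<and> src \<A> q = tgt \<A> h \<and>
     p \<cdot>\<^bsub>\<A>\<^esub> f = q \<cdot>\<^bsub>\<A>\<^esub> h \<and>
     (\<forall>W \<in> Ob \<A>. \<forall>a \<in> Hom \<A> (tgt \<A> f) W. \<forall>b \<in> Hom \<A> (tgt \<A> h) W.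
        a \<cdot>\<^bsub>\<A>\<^esub> f = b \<cdot>\<^bsub>\<A>\<^esub> h \<longrightarrow>
        (\<exists>!u. u \<in> Hom \<A> (tgt \<A> p) W \<and> u \<cdot>\<^bsub>\<A>\<^esub> p = a \<and> u \<cdot>\<^bsub>\<A>\<^esub> q = b))"

record ('o, 'm) add_cat = "('o, 'm) cat" +
  hadd :: "'m \<Rightarrow> 'm \<Rightarrow> 'm"  (infixl \<open>\<boxplus>\<index>\<close> 65)
  hzero :: "'o \<Rightarrow> 'o \<Rightarrow> 'm"

text \<open>The additive group of morphisms, presented as a (multiplicatively written) library group.\<close>

definition hom_group :: "('o, 'm, 'z) add_cat_scheme \<Rightarrow> 'o \<Rightarrow> 'o \<Rightarrow> 'm monoid" where
  "hom_group \<A> X Y =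
     \<lparr>carrier = Hom \<A> X Y, monoid.mult = (\<lambda>f g. f \<boxplus>\<^bsub>\<A>\<^esub> g), one = hzero \<A> X Y\<rparr>"

definition is_biproduct ::
  "('o, 'm, 'z) add_cat_scheme \<Rightarrow> 'o \<Rightarrow> 'o \<Rightarrow> 'o \<Rightarrow> 'm \<Rightarrow> 'm \<Rightarrow> 'm \<Rightarrow> 'm \<Rightarrow> bool" where
  "is_biproduct \<A> X Y P i j p q \<longleftrightarrow>
     X \<in> Ob \<A> \<and> Y \<in> Ob \<A> \<and> P \<in> Ob \<A> \<and>
     i \<in> Hom \<A> X P \<and> j \<in> Hom \<A> Y P \<and> p \<in> Hom \<A> P X \<and> q \<in> Hom \<A> P Y \<and>
     p \<cdot>\<^bsub>\<A>\<^esub> i = ide \<A> X \<and> q \<cdot>\<^bsub>\<A>\<^esub> j = ide \<A> Y \<and>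
     p \<cdot>\<^bsub>\<A>\<^esub> j = hzero \<A> Y X \<and> q \<cdot>\<^bsub>\<A>\<^esub> i = hzero \<A> X Y \<and>
     (i \<cdot>\<^bsub>\<A>\<^esub> p) \<boxplus>\<^bsub>\<A>\<^esub> (j \<cdot>\<^bsub>\<A>\<^esub> q) = ide \<A> P"

locale additive_category = category \<A> for \<A> (structure) +
  assumes hom_comm_group:
      "X \<in> Ob \<A> \<Longrightarrow> Y \<in> Ob \<A> \<Longrightarrow> comm_group (hom_group \<A> X Y)"
    and cmp_hadd: "f \<in> Hom \<A> X Y \<Longrightarrow> f' \<in> Hom \<A> X Y \<Longrightarrow> g \<in> Hom \<A> Y Z \<Longrightarrow>
      g \<cdot> (f \<boxplus> f') = (g \<cdot> f) \<boxplus> (g \<cdot> f')"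
    and hadd_cmp: "f \<in> Hom \<A> X Y \<Longrightarrow> g \<in> Hom \<A> Y Z \<Longrightarrow> g' \<in> Hom \<A> Y Z \<Longrightarrow>
      (g \<boxplus> g') \<cdot> f = (g \<cdot> f) \<boxplus> (g' \<cdot> f)"
    and zero_object_exists: "\<exists>Z. zero_object \<A> Z"
    and biproduct_exists: "X \<in> Ob \<A> \<Longrightarrow> Y \<in> Ob \<A> \<Longrightarrow>
      \<exists>P i j p q. is_biproduct \<A> X Y P i j p q"

definition indecomposable :: "('o, 'm, 'z) add_cat_scheme \<Rightarrow> 'o \<Rightarrow> bool" where
  "indecomposable \<A> X \<longleftrightarrow> X \<in> Ob \<A> \<and> \<not> zero_object \<A> X \<and>
     (\<forall>Y Z i j p q. is_biproduct \<A> Y Z X i j p q \<longrightarrow> zero_object \<A> Y \<or> zero_object \<A> Z)"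

definition is_kernel :: "('o, 'm, 'z) add_cat_scheme \<Rightarrow> 'm \<Rightarrow> 'm \<Rightarrow> bool" where
  \<comment> \<open>\<open>f\<close> is a kernel of \<open>g\<close>\<close>
  "is_kernel \<A> f g \<longleftrightarrow> f \<in> Ar \<A> \<and> g \<in> Ar \<A> \<and> tgt \<A> f = src \<A> g \<and>
     g \<cdot>\<^bsub>\<A>\<^esub> f = hzero \<A> (src \<A> f) (tgt \<A> g) \<and>
     (\<forall>W \<in> Ob \<A>. \<forall>h \<in> Hom \<A> W (src \<A> g). g \<cdot>\<^bsub>\<A>\<^esub> h = hzero \<A> W (tgt \<A> g) \<longrightarrow>
        (\<exists>!u. u \<in> Hom \<A> W (src \<A> f) \<and> f \<cdot>\<^bsub>\<A>\<^esub> u = h))"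

definition is_cokernel :: "('o, 'm, 'z) add_cat_scheme \<Rightarrow> 'm \<Rightarrow> 'm \<Rightarrow> bool" where
  \<comment> \<open>\<open>g\<close> is a cokernel of \<open>f\<close>\<close>
  "is_cokernel \<A> g f \<longleftrightarrow> f \<in> Ar \<A> \<and> g \<in> Ar \<A> \<and> tgt \<A> f = src \<A> g \<and>
     g \<cdot>\<^bsub>\<A>\<^esub> f = hzero \<A> (src \<A> f) (tgt \<A> g) \<and>
     (\<forall>W \<in> Ob \<A>. \<forall>h \<in> Hom \<A> (tgt \<A> f) W. h \<cdot>\<^bsub>\<A>\<^esub> f = hzero \<A> (src \<A> f) W \<longrightarrow>
        (\<exists>!u. u \<in> Hom \<A> (tgt \<A> g) W \<and> u \<cdot>\<^bsub>\<A>\<^esub> g = h))"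

record ('o, 'm) ex_cat = "('o, 'm) add_cat" +
  conflations :: "('m \<times> 'm) set"

definition admissible_mono :: "('o, 'm, 'z) ex_cat_scheme \<Rightarrow> 'm \<Rightarrow> bool" where
  "admissible_mono \<A> f \<longleftrightarrow> (\<exists>g. (f, g) \<in> conflations \<A>)"

definition admissible_epi :: "('o, 'm, 'z) ex_cat_scheme \<Rightarrow> 'm \<Rightarrow> bool" where
  "admissible_epi \<A> g \<longleftrightarrow> (\<exists>f. (f, g) \<in> conflations \<A>)"

text \<open>
  Quillen's axioms.  His last axiom (the ``obscure'' one: a morphism that has a kernel is an
  admissible epi as soon as some composite with it is, and dually) is omitted, since it follows
  from the others (Yoneda, Keller).
\<close>

locale exact_category = additive_category \<A> for \<A> (structure) +
  assumes conflation_kernel: "(f, g) \<in> conflations \<A> \<Longrightarrow> is_kernel \<A> f g"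
    and conflation_cokernel: "(f, g) \<in> conflations \<A> \<Longrightarrow> is_cokernel \<A> g f"
    and conflation_iso_closed:
      "\<lbrakk>(f, g) \<in> conflations \<A>; f \<in> Hom \<A> B X; g \<in> Hom \<A> X A;
        f' \<in> Hom \<A> B' X'; g' \<in> Hom \<A> X' A';
        b \<in> Isos \<A> B B'; x \<in> Isos \<A> X X'; a \<in> Isos \<A> A A';
        f' \<cdot> b = x \<cdot> f; g' \<cdot> x = a \<cdot> g\<rbrakk> \<Longrightarrow> (f', g') \<in> conflations \<A>"
    and conflation_split: "is_biproduct \<A> X Y P i j p q \<Longrightarrow> (i, q) \<in> conflations \<A>"
    and admissible_epi_cmp:
      "\<lbrakk>admissible_epi \<A> g; admissible_epi \<A> h; tgt \<A> g = src \<A> h\<rbrakk> \<Longrightarrow>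
        admissible_epi \<A> (h \<cdot> g)"
    and admissible_epi_base_change:
      "\<lbrakk>admissible_epi \<A> g; h \<in> Ar \<A>; tgt \<A> h = tgt \<A> g\<rbrakk> \<Longrightarrow>
        \<exists>p q. is_pullback \<A> g h p q \<and> admissible_epi \<A> q"
    and admissible_mono_cmp:
      "\<lbrakk>admissible_mono \<A> f; admissible_mono \<A> h; tgt \<A> f = src \<A> h\<rbrakk> \<Longrightarrow>
        admissible_mono \<A> (h \<cdot> f)"
    and admissible_mono_cobase_change:
      "\<lbrakk>admissible_mono \<A> f; h \<in> Ar \<A>; src \<A> h = src \<A> f\<rbrakk> \<Longrightarrow>
        \<exists>p q. is_pushout \<A> f h p q \<and> admissible_mono \<A> q"

definition ses :: "('o, 'm, 'z) ex_cat_scheme \<Rightarrow> 'o \<Rightarrow> 'o \<Rightarrow> 'o \<Rightarrow> ('m \<times> 'm) set" where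
  \<comment> \<open>\<open>\<E>(A,B)\<^sub>X\<close>, the conflations with subobject \<open>B\<close>, middle term \<open>X\<close> and quotient \<open>A\<close>\<close>
  "ses \<A> A B X = {(f, g). (f, g) \<in> conflations \<A> \<and> f \<in> Hom \<A> B X \<and> g \<in> Hom \<A> X A}"

definition Ext1 :: "('o, 'm, 'z) ex_cat_scheme \<Rightarrow> 'o \<Rightarrow> 'o \<Rightarrow> 'o set set" where
  \<comment> \<open>The set of classes of middle terms, not the group of extension classes\<close>
  "Ext1 \<A> A B = {iso_class \<A> X | X. X \<in> Ob \<A> \<and> ses \<A> A B X \<noteq> {}}"

locale finitary_exact_category = exact_category \<A> for \<A> (structure) +
  assumes finite_Hom: "X \<in> Ob \<A> \<Longrightarrow> Y \<in> Ob \<A> \<Longrightarrow> finite (Hom \<A> X Y)"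
    and finite_Ext1: "A \<in> Ob \<A> \<Longrightarrow> B \<in> Ob \<A> \<Longrightarrow> finite (Ext1 \<A> A B)"

definition hall_number :: "('o, 'm, 'z) ex_cat_scheme \<Rightarrow> 'o \<Rightarrow> 'o \<Rightarrow> 'o \<Rightarrow> rat" where
  "hall_number \<A> A B X =
     of_nat (card (ses \<A> A B X)) / (of_nat (card (Aut \<A> A)) * of_nat (card (Aut \<A> B)))"

text \<open>
  The Hall algebra consists of the finitely supported rational functions on the set of isomorphism
  classes.  Hall numbers depend only on the isomorphism classes of their arguments, so the product
  is defined by means of arbitrary representatives.
\<close>

definition hall_space :: "('o, 'm, 'z) ex_cat_scheme \<Rightarrow> ('o set \<Rightarrow>\<^sub>0 rat) set" where
  "hall_space \<A> = {u. Poly_Mapping.keys u \<subseteq> iso_classes \<A>}"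

definition hall_scale :: "rat \<Rightarrow> ('o set \<Rightarrow>\<^sub>0 rat) \<Rightarrow> ('o set \<Rightarrow>\<^sub>0 rat)" where
  "hall_scale r u = Poly_Mapping.map (\<lambda>s. r * s) u"

definition hall_basis :: "('o, 'm, 'z) ex_cat_scheme \<Rightarrow> 'o \<Rightarrow> ('o set \<Rightarrow>\<^sub>0 rat)" where
  "hall_basis \<A> X = Poly_Mapping.single (iso_class \<A> X) 1"

definition class_rep :: "'o set \<Rightarrow> 'o" where
  "class_rep c = (SOME X. X \<in> c)"

definition hall_basis_mult ::
  "('o, 'm, 'z) ex_cat_scheme \<Rightarrow> 'o \<Rightarrow> 'o \<Rightarrow> ('o set \<Rightarrow>\<^sub>0 rat)" where
  \<comment> \<open>The sum over all classes \<open>c\<close> reduces to \<open>Ext1\<close>: the other Hall numbers vanish\<close>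
  "hall_basis_mult \<A> A B =
     (\<Sum>c \<in> Ext1 \<A> A B. Poly_Mapping.single c (hall_number \<A> A B (class_rep c)))"

definition hall_mult ::
  "('o, 'm, 'z) ex_cat_scheme \<Rightarrow> ('o set \<Rightarrow>\<^sub>0 rat) \<Rightarrow> ('o set \<Rightarrow>\<^sub>0 rat) \<Rightarrow> ('o set \<Rightarrow>\<^sub>0 rat)" where
  "hall_mult \<A> u v =
     (\<Sum>a \<in> Poly_Mapping.keys u. \<Sum>b \<in> Poly_Mapping.keys v.
        hall_scale (Poly_Mapping.lookup u a * Poly_Mapping.lookup v b)
          (hall_basis_mult \<A> (class_rep a) (class_rep b)))"

definition hall_one :: "('o, 'm, 'z) ex_cat_scheme \<Rightarrow> ('o set \<Rightarrow>\<^sub>0 rat)" where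
  "hall_one \<A> = hall_basis \<A> (SOME Z. zero_object \<A> Z)"

definition hall_subalgebra ::
  "('o, 'm, 'z) ex_cat_scheme \<Rightarrow> ('o set \<Rightarrow>\<^sub>0 rat) set \<Rightarrow> bool" where
  "hall_subalgebra \<A> T \<longleftrightarrow> T \<subseteq> hall_space \<A> \<and> 0 \<in> T \<and> hall_one \<A> \<in> T \<and>
     (\<forall>u \<in> T. \<forall>v \<in> T. u + v \<in> T) \<and>
     (\<forall>r. \<forall>u \<in> T. hall_scale r u \<in> T) \<and>
     (\<forall>u \<in> T. \<forall>v \<in> T. hall_mult \<A> u v \<in> T)"

end

theory Submission
  imports Defs
begin

text \<open>
  For a conflation \<open>B \<rightarrow> X \<rightarrow> A\<close>, left exactness of the Hom functors gives
  \<open>|End X| \<le> |Hom(X,A)| |Hom(X,B)| \<le> |Hom(B,A)| |End A| |R| |Hom(A,B)|\<close>, where \<open>R \<subseteq> End B\<close> consists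
  of the endomorphisms that extend along \<open>B \<rightarrow> X\<close>.  If the conflation does not split, then \<open>R\<close> omits
  the identity, hence \<open>|End X| < |End (B \<oplus> A)|\<close>.  Thus for a decomposable object \<open>X = B \<oplus> A\<close> the
  product \<open>[A][B]\<close> is a nonzero multiple of \<open>[X]\<close> plus a combination of classes \<open>[C]\<close> with
  \<open>|End C| < |End X|\<close>; also \<open>|End A|\<close> and \<open>|End B|\<close> are smaller than \<open>|End X|\<close>, so that strong
  induction on \<open>|End X|\<close> puts every \<open>[X]\<close> into the subalgebra.
\<close>

section \<open>Composition, isomorphisms and isomorphism classes\<close>

context category
begin

lemma Hom_iff: "f \<in> Hom \<A> X Y \<longleftrightarrow> f \<in> Ar \<A> \<and> src \<A> f = X \<and> tgt \<A> f = Y"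
  by (simp add: Hom_def)

lemma Hom_Ob: "f \<in> Hom \<A> X Y \<Longrightarrow> X \<in> Ob \<A> \<and> Y \<in> Ob \<A>"
  using src_Ob tgt_Ob by (auto simp: Hom_iff)

text \<open>In the \<open>Hom\<close> form of the axioms the objects have to be guessed, as they
  need not occur in the term to be rewritten. With typing expressed by \<open>Ar\<close>,
  \<open>src\<close> and \<open>tgt\<close>, the side conditions become equations that rewriting can
  check.\<close>

lemma Ar_cmp:
  assumes "f \<in> Ar \<A>" "g \<in> Ar \<A>" "tgt \<A> f = src \<A> g"
  shows "g \<cdot> f \<in> Ar \<A>" "src \<A> (g \<cdot> f) = src \<A> f" "tgt \<A> (g \<cdot> f) = tgt \<A> g"
  using cmp_Hom[of f "src \<A> f" "src \<A> g" g "tgt \<A> g"] assms by (auto simp: Hom_iff)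

lemma Ar_ide:
  assumes "X \<in> Ob \<A>"
  shows "ide \<A> X \<in> Ar \<A>" "src \<A> (ide \<A> X) = X" "tgt \<A> (ide \<A> X) = X"
  using ide_Hom[OF assms] by (auto simp: Hom_iff)

lemma cmp_ide_Ar: "f \<in> Ar \<A> \<Longrightarrow> src \<A> f = X \<Longrightarrow> f \<cdot> ide \<A> X = f"
  using cmp_ide[of f X "tgt \<A> f"] by (simp add: Hom_iff)

lemma ide_cmp_Ar: "f \<in> Ar \<A> \<Longrightarrow> tgt \<A> f = Y \<Longrightarrow> ide \<A> Y \<cdot> f = f"
  using ide_cmp[of f "src \<A> f" Y] by (simp add: Hom_iff)

lemma cmp_assoc_Ar:
  assumes "f \<in> Ar \<A>" "g \<in> Ar \<A>" "h \<in> Ar \<A>" "tgt \<A> f = src \<A> g" "tgt \<A> g = src \<A> h"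
  shows "(h \<cdot> g) \<cdot> f = h \<cdot> (g \<cdot> f)"
  using cmp_assoc[of f "src \<A> f" "src \<A> g" g "src \<A> h" h "tgt \<A> h"] assms
  by (simp add: Hom_iff)

text \<open>Composites are normalised to right-nested form, in which \<open>g \<cdot> f\<close> is
  no longer a subterm; this variant lets an equation for \<open>g \<cdot> f\<close> apply there as
  well.\<close>

lemma cmp_cmp_eq:
  assumes "g \<cdot> f = h" "f \<in> Ar \<A>" "g \<in> Ar \<A>" "tgt \<A> f = src \<A> g" "x \<in> Ar \<A>" "tgt \<A> x = src \<A> f"
  shows "g \<cdot> (f \<cdot> x) = h \<cdot> x"
  using cmp_assoc_Ar[of x f g] assms by simp

lemmas category_simps = Hom_iff Ar_cmp Ar_ide cmp_ide_Ar ide_cmp_Ar cmp_assoc_Ar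

lemma IsosE:
  assumes "f \<in> Isos \<A> X Y"
  obtains g where "f \<in> Hom \<A> X Y" "g \<in> Hom \<A> Y X" "g \<cdot> f = ide \<A> X" "f \<cdot> g = ide \<A> Y"
  using assms by (auto simp: Isos_def)

lemma IsosI:
  "\<lbrakk>f \<in> Hom \<A> X Y; g \<in> Hom \<A> Y X; g \<cdot> f = ide \<A> X; f \<cdot> g = ide \<A> Y\<rbrakk> \<Longrightarrow> f \<in> Isos \<A> X Y"
  by (auto simp: Isos_def)

lemma ide_Isos: "X \<in> Ob \<A> \<Longrightarrow> ide \<A> X \<in> Isos \<A> X X"
  by (rule IsosI[of _ _ _ "ide \<A> X"]) (simp_all add: category_simps)

lemma Isos_sym: "Isos \<A> X Y \<noteq> {} \<Longrightarrow> Isos \<A> Y X \<noteq> {}"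
  by (auto simp: Isos_def)

lemma Isos_cmp:
  assumes "f \<in> Isos \<A> X Y" "g \<in> Isos \<A> Y Z"
  shows "g \<cdot> f \<in> Isos \<A> X Z"
proof -
  obtain f' where f: "f \<in> Hom \<A> X Y" "f' \<in> Hom \<A> Y X" "f' \<cdot> f = ide \<A> X" "f \<cdot> f' = ide \<A> Y"
    using assms(1) by (rule IsosE)
  obtain g' where g: "g \<in> Hom \<A> Y Z" "g' \<in> Hom \<A> Z Y" "g' \<cdot> g = ide \<A> Y" "g \<cdot> g' = ide \<A> Z"
    using assms(2) by (rule IsosE)
  note ar = f(1,2) g(1,2)
  have "g' \<cdot> (g \<cdot> f) = f" "f \<cdot> (f' \<cdot> g') = g'"
    using ar cmp_cmp_eq[OF g(3), of f] cmp_cmp_eq[OF f(4), of g'] by (auto simp: category_simps)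
  then show ?thesis
    using ar f(3) g(4) by (intro IsosI[of _ _ _ "f' \<cdot> g'"]) (auto simp: category_simps)
qed

lemma iso_class_eq:
  assumes "Isos \<A> X Y \<noteq> {}"
  shows "iso_class \<A> X = iso_class \<A> Y"
  using assms Isos_sym[OF assms] Isos_cmp unfolding iso_class_def by blast

lemma class_rep_iso_class:
  assumes "X \<in> Ob \<A>"
  shows "class_rep (iso_class \<A> X) \<in> Ob \<A>" "Isos \<A> X (class_rep (iso_class \<A> X)) \<noteq> {}"
proof -
  have "X \<in> iso_class \<A> X"
    using assms ide_Isos by (auto simp: iso_class_def)
  then have "class_rep (iso_class \<A> X) \<in> iso_class \<A> X"
    unfolding class_rep_def by (rule someI)
  then show "class_rep (iso_class \<A> X) \<in> Ob \<A>" "Isos \<A> X (class_rep (iso_class \<A> X)) \<noteq> {}"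
    by (auto simp: iso_class_def)
qed

end

section \<open>Addition of morphisms, zero morphisms and zero objects\<close>

context additive_category
begin

lemma Ar_hzero:
  assumes "X \<in> Ob \<A>" "Y \<in> Ob \<A>"
  shows "hzero \<A> X Y \<in> Ar \<A>" "src \<A> (hzero \<A> X Y) = X" "tgt \<A> (hzero \<A> X Y) = Y"
proof -
  interpret G: comm_group "hom_group \<A> X Y" using assms by (rule hom_comm_group)
  show "hzero \<A> X Y \<in> Ar \<A>" "src \<A> (hzero \<A> X Y) = X" "tgt \<A> (hzero \<A> X Y) = Y"
    using G.one_closed by (auto simp: hom_group_def Hom_iff)
qed

lemma hadd_Hom:
  assumes "f \<in> Hom \<A> X Y" "g \<in> Hom \<A> X Y"
  shows "f \<boxplus> g \<in> Hom \<A> X Y"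
proof -
  interpret G: comm_group "hom_group \<A> X Y" using assms Hom_Ob by (blast intro: hom_comm_group)
  show ?thesis using G.m_closed[of f g] assms by (simp add: hom_group_def)
qed

lemma Ar_hadd:
  assumes "f \<in> Ar \<A>" "g \<in> Ar \<A>" "src \<A> f = src \<A> g" "tgt \<A> f = tgt \<A> g"
  shows "f \<boxplus> g \<in> Ar \<A>" "src \<A> (f \<boxplus> g) = src \<A> g" "tgt \<A> (f \<boxplus> g) = tgt \<A> g"
  using hadd_Hom[of f "src \<A> f" "tgt \<A> f" g] assms by (auto simp: Hom_iff)

lemma hadd_commute:
  assumes "f \<in> Hom \<A> X Y" "g \<in> Hom \<A> X Y"
  shows "f \<boxplus> g = g \<boxplus> f"
proof -
  interpret G: comm_group "hom_group \<A> X Y" using assms Hom_Ob by (blast intro: hom_comm_group)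
  show ?thesis using G.m_comm[of f g] assms by (simp add: hom_group_def)
qed

lemma hzero_hadd:
  assumes "f \<in> Ar \<A>" "src \<A> f = X" "tgt \<A> f = Y"
  shows "hzero \<A> X Y \<boxplus> f = f" "f \<boxplus> hzero \<A> X Y = f"
proof -
  interpret G: comm_group "hom_group \<A> X Y" using assms src_Ob tgt_Ob by (blast intro: hom_comm_group)
  show "hzero \<A> X Y \<boxplus> f = f" "f \<boxplus> hzero \<A> X Y = f"
    using G.l_one[of f] G.r_one[of f] assms by (simp_all add: hom_group_def Hom_iff)
qed

lemma hadd_right_eq_self:
  assumes "f \<in> Hom \<A> X Y" "d \<in> Hom \<A> X Y" "f \<boxplus> d = f"
  shows "d = hzero \<A> X Y"
proof -
  interpret G: comm_group "hom_group \<A> X Y" using assms Hom_Ob by (blast intro: hom_comm_group)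
  show ?thesis using G.l_cancel_one[of f d] assms by (simp add: hom_group_def)
qed

text \<open>The signature has no negation: \<open>d\<close> stands for \<open>g\<close> minus
  \<open>f\<close>, and \<open>hadd_right_eq_self\<close> is the matching way to show that such a
  difference vanishes.\<close>

lemma hadd_diff_exists:
  assumes "f \<in> Hom \<A> X Y" "g \<in> Hom \<A> X Y"
  obtains d where "d \<in> Hom \<A> X Y" "f \<boxplus> d = g"
proof -
  interpret G: comm_group "hom_group \<A> X Y" using assms Hom_Ob by (blast intro: hom_comm_group)
  let ?d = "inv\<^bsub>hom_group \<A> X Y\<^esub> f \<otimes>\<^bsub>hom_group \<A> X Y\<^esub> g"
  have c: "f \<in> carrier (hom_group \<A> X Y)" "g \<in> carrier (hom_group \<A> X Y)"
    using assms by (simp_all add: hom_group_def)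
  then have "?d \<in> carrier (hom_group \<A> X Y)" by simp
  moreover have "f \<otimes>\<^bsub>hom_group \<A> X Y\<^esub> ?d = g"
    using c by (simp add: G.m_assoc[symmetric])
  ultimately show thesis by (intro that[of ?d]) (simp_all add: hom_group_def)
qed

lemma cmp_hadd_Ar:
  assumes "f \<in> Ar \<A>" "f' \<in> Ar \<A>" "g \<in> Ar \<A>" "src \<A> f = src \<A> f'" "tgt \<A> f = src \<A> g" "tgt \<A> f' = src \<A> g"
  shows "g \<cdot> (f \<boxplus> f') = (g \<cdot> f) \<boxplus> (g \<cdot> f')"
  using cmp_hadd[of f "src \<A> f" "src \<A> g" f' g "tgt \<A> g"] assms by (simp add: Hom_iff)

lemma hadd_cmp_Ar:
  assumes "f \<in> Ar \<A>" "g \<in> Ar \<A>" "g' \<in> Ar \<A>" "src \<A> g = tgt \<A> f" "src \<A> g' = tgt \<A> f" "tgt \<A> g = tgt \<A> g'"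
  shows "(g \<boxplus> g') \<cdot> f = (g \<cdot> f) \<boxplus> (g' \<cdot> f)"
  using hadd_cmp[of f "src \<A> f" "tgt \<A> f" g "tgt \<A> g" g'] assms by (simp add: Hom_iff)

text \<open>The zero morphism is its own double, hence so is its composite with \<open>g\<close>,
  and cancellation leaves zero.\<close>

lemma cmp_hzero:
  assumes "g \<in> Ar \<A>" "X \<in> Ob \<A>" "src \<A> g = Y"
  shows "g \<cdot> hzero \<A> X Y = hzero \<A> X (tgt \<A> g)"
proof -
  let ?z = "hzero \<A> X Y"
  have z: "?z \<in> Hom \<A> X Y" using assms src_Ob by (auto simp: Hom_iff Ar_hzero)
  then have "(g \<cdot> ?z) \<boxplus> (g \<cdot> ?z) = g \<cdot> ?z"
    using assms cmp_hadd_Ar[of ?z ?z g] hzero_hadd(1)[of ?z X Y] by (simp add: Hom_iff)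
  then show ?thesis
    using z assms by (intro hadd_right_eq_self[of "g \<cdot> ?z"]) (simp_all add: category_simps)
qed

lemma hzero_cmp:
  assumes "f \<in> Ar \<A>" "Z \<in> Ob \<A>" "tgt \<A> f = Y"
  shows "hzero \<A> Y Z \<cdot> f = hzero \<A> (src \<A> f) Z"
proof -
  let ?z = "hzero \<A> Y Z"
  have z: "?z \<in> Hom \<A> Y Z" using assms tgt_Ob by (auto simp: Hom_iff Ar_hzero)
  then have "(?z \<cdot> f) \<boxplus> (?z \<cdot> f) = ?z \<cdot> f"
    using assms hadd_cmp_Ar[of f ?z ?z] hzero_hadd(1)[of ?z Y Z] by (simp add: Hom_iff)
  then show ?thesis
    using z assms by (intro hadd_right_eq_self[of "?z \<cdot> f"]) (simp_all add: category_simps)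
qed

lemmas additive_simps =
  category_simps Ar_hzero Ar_hadd hzero_hadd cmp_hadd_Ar hadd_cmp_Ar cmp_hzero hzero_cmp

text \<open>Inserting the identity of \<open>X\<close> into a morphism to or from \<open>X\<close>
  turns it into a composite with zero.\<close>

lemma zero_object_if_ide_eq_hzero:
  assumes "X \<in> Ob \<A>" "ide \<A> X = hzero \<A> X X"
  shows "zero_object \<A> X"
proof -
  have "f = hzero \<A> Y X" if "f \<in> Hom \<A> Y X" for f Y
    using ide_cmp[OF that] that assms by (simp add: additive_simps)
  moreover have "f = hzero \<A> X Y" if "f \<in> Hom \<A> X Y" for f Y
    using cmp_ide[OF that] that assms by (simp add: additive_simps)
  moreover have "hzero \<A> Y X \<in> Hom \<A> Y X" "hzero \<A> X Y \<in> Hom \<A> X Y" if "Y \<in> Ob \<A>" for Y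
    using that assms by (simp_all add: additive_simps)
  ultimately show ?thesis
    using assms(1) unfolding zero_object_def by blast
qed

lemma zero_objects_iso:
  assumes "zero_object \<A> X" "zero_object \<A> Y"
  shows "Isos \<A> X Y \<noteq> {}"
proof -
  have Ob: "X \<in> Ob \<A>" "Y \<in> Ob \<A>" using assms by (auto simp: zero_object_def)
  obtain f g where fg: "f \<in> Hom \<A> X Y" "g \<in> Hom \<A> Y X"
    using assms Ob unfolding zero_object_def by meson
  then have "g \<cdot> f = ide \<A> X" "f \<cdot> g = ide \<A> Y"
    using assms Ob cmp_Hom ide_Hom unfolding zero_object_def by metis+
  then show ?thesis using fg IsosI by blast
qed

section \<open>Biproducts: transport, uniqueness and counts of morphisms\<close>

lemma biproduct_sym:
  assumes "is_biproduct \<A> X Y P i j p q"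
  shows "is_biproduct \<A> Y X P j i q p"
proof -
  have "(i \<cdot> p) \<boxplus> (j \<cdot> q) = (j \<cdot> q) \<boxplus> (i \<cdot> p)"
    using assms unfolding is_biproduct_def
    by (intro hadd_commute[of _ P P]) (auto simp: category_simps)
  then show ?thesis using assms unfolding is_biproduct_def by auto
qed

lemma biproduct_iso_middle:
  assumes bp: "is_biproduct \<A> X Y P i j p q" and c: "c \<in> Isos \<A> P P'"
  shows "\<exists>i j p q. is_biproduct \<A> X Y P' i j p q"
proof -
  obtain c' where c': "c \<in> Hom \<A> P P'" "c' \<in> Hom \<A> P' P" "c' \<cdot> c = ide \<A> P" "c \<cdot> c' = ide \<A> P'"
    using c by (rule IsosE)
  note b = bp[unfolded is_biproduct_def]
  have Ob: "P' \<in> Ob \<A>" using c' Hom_Ob by blast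
  have e: "c' \<cdot> (c \<cdot> i) = i" "c' \<cdot> (c \<cdot> j) = j"
    using cmp_cmp_eq[OF c'(3)] c'(1,2) b by (simp_all add: additive_simps)
  have "i \<in> Hom \<A> X P" "j \<in> Hom \<A> Y P" "p \<in> Hom \<A> P X" "q \<in> Hom \<A> P Y" using b by auto
  then have "(c \<cdot> (i \<cdot> (p \<cdot> c'))) \<boxplus> (c \<cdot> (j \<cdot> (q \<cdot> c'))) = c \<cdot> (((i \<cdot> p) \<boxplus> (j \<cdot> q)) \<cdot> c')"
    using c'(1,2) by (simp add: additive_simps)
  also have "\<dots> = ide \<A> P'"
    using b c' by (simp add: ide_cmp_Ar Hom_iff)
  finally have "is_biproduct \<A> X Y P' (c \<cdot> i) (c \<cdot> j) (p \<cdot> c') (q \<cdot> c')"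
    using b c'(1,2) e Ob unfolding is_biproduct_def by (simp add: additive_simps)
  then show ?thesis by blast
qed

lemma biproduct_iso_left:
  assumes bp: "is_biproduct \<A> X Y P i j p q" and a: "a \<in> Isos \<A> X X'"
  shows "\<exists>i j p q. is_biproduct \<A> X' Y P i j p q"
proof -
  obtain a' where a': "a \<in> Hom \<A> X X'" "a' \<in> Hom \<A> X' X" "a' \<cdot> a = ide \<A> X" "a \<cdot> a' = ide \<A> X'"
    using a by (rule IsosE)
  note b = bp[unfolded is_biproduct_def]
  have Ob: "X' \<in> Ob \<A>" using a' Hom_Ob by blast
  have e: "a' \<cdot> (a \<cdot> p) = p" "p \<cdot> (i \<cdot> a') = a'" "q \<cdot> (i \<cdot> a') = hzero \<A> X' Y"
    using cmp_cmp_eq[OF a'(3), of p] cmp_cmp_eq[of p i "ide \<A> X" a']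
      cmp_cmp_eq[of q i "hzero \<A> X Y" a'] a'(1,2) b by (simp_all add: additive_simps)
  have "is_biproduct \<A> X' Y P (i \<cdot> a') j (a \<cdot> p) q"
    using b a' e Ob unfolding is_biproduct_def by (simp add: additive_simps)
  then show ?thesis by blast
qed

text \<open>\<open>hall_mult\<close> passes to chosen representatives of classes, so decompositions
  must be movable along isomorphisms of all three objects. The second summand is treated as a first
  one after \<open>biproduct_sym\<close>.\<close>

lemma biproduct_iso:
  assumes "is_biproduct \<A> X Y P i j p q"
    and "Isos \<A> X X' \<noteq> {}" "Isos \<A> Y Y' \<noteq> {}" "Isos \<A> P P' \<noteq> {}"
  shows "\<exists>i j p q. is_biproduct \<A> X' Y' P' i j p q"
proof -
  obtain a b c where abc: "a \<in> Isos \<A> X X'" "b \<in> Isos \<A> Y Y'" "c \<in> Isos \<A> P P'"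
    using assms by blast
  obtain i j p q where "is_biproduct \<A> X' Y P i j p q"
    using biproduct_iso_left[OF assms(1) abc(1)] by blast
  from biproduct_iso_left[OF biproduct_sym[OF this] abc(2)]
  obtain i j p q where "is_biproduct \<A> Y' X' P i j p q" by blast
  from biproduct_iso_middle[OF biproduct_sym[OF this] abc(3)] show ?thesis .
qed

lemma biproduct_unique:
  assumes P: "is_biproduct \<A> X Y P i j p q" and Q: "is_biproduct \<A> X Y Q i' j' p' q'"
  shows "Isos \<A> P Q \<noteq> {}"
proof -
  \<comment> \<open>The composite of the comparison maps
    \<open>P \<rightarrow> Q \<rightarrow> P\<close>, stated for arbitrary biproducts so that
    exchanging \<open>P\<close> and \<open>Q\<close> yields the other composite.\<close>
  have inverse: "((i \<cdot> p') \<boxplus> (j \<cdot> q')) \<cdot> ((i' \<cdot> p) \<boxplus> (j' \<cdot> q)) = ide \<A> P"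
    if "is_biproduct \<A> X Y P i j p q" "is_biproduct \<A> X Y Q i' j' p' q'" for P Q i j p q i' j' p' q'
  proof -
    note b = that[unfolded is_biproduct_def]
    have "p' \<cdot> (i' \<cdot> p) = p" "p' \<cdot> (j' \<cdot> q) = hzero \<A> P X"
      "q' \<cdot> (i' \<cdot> p) = hzero \<A> P Y" "q' \<cdot> (j' \<cdot> q) = q"
      using cmp_cmp_eq[of p' i' "ide \<A> X" p] cmp_cmp_eq[of p' j' "hzero \<A> Y X" q]
        cmp_cmp_eq[of q' i' "hzero \<A> X Y" p] cmp_cmp_eq[of q' j' "ide \<A> Y" q] b
      by (simp_all add: additive_simps)
    then show ?thesis using b by (simp add: additive_simps)
  qed
  show ?thesis
    using P Q IsosI[OF _ _ inverse[OF P Q] inverse[OF Q P]]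
    unfolding is_biproduct_def by (auto simp: additive_simps)
qed

text \<open>Restrictions to the two summands can be prescribed freely:
  \<open>(u \<cdot> p) \<boxplus> (v \<cdot> q)\<close> restricts to \<open>u\<close> along
  \<open>i\<close> and to \<open>v\<close> along \<open>j\<close>.\<close>

lemma card_Hom_from_biproduct:
  assumes bp: "is_biproduct \<A> X Y P i j p q" and fin: "finite (Hom \<A> P W)" and W: "W \<in> Ob \<A>"
  shows "card (Hom \<A> X W) * card (Hom \<A> Y W) \<le> card (Hom \<A> P W)"
proof -
  note b = bp[unfolded is_biproduct_def]
  have "(u, v) \<in> (\<lambda>w. (w \<cdot> i, w \<cdot> j)) ` Hom \<A> P W" if uv: "u \<in> Hom \<A> X W" "v \<in> Hom \<A> Y W" for u v
    using b uv W by (intro image_eqI[of _ _ "(u \<cdot> p) \<boxplus> (v \<cdot> q)"]) (simp_all add: additive_simps)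
  then have "Hom \<A> X W \<times> Hom \<A> Y W \<subseteq> (\<lambda>w. (w \<cdot> i, w \<cdot> j)) ` Hom \<A> P W" by auto
  from surj_card_le[OF fin this] show ?thesis by (simp add: card_cartesian_product)
qed

text \<open>Dually, \<open>(i \<cdot> u) \<boxplus> (j \<cdot> v)\<close> has the prescribed
  components \<open>u\<close> and \<open>v\<close>.\<close>

lemma card_Hom_to_biproduct:
  assumes bp: "is_biproduct \<A> X Y P i j p q" and fin: "finite (Hom \<A> W P)" and W: "W \<in> Ob \<A>"
  shows "card (Hom \<A> W X) * card (Hom \<A> W Y) \<le> card (Hom \<A> W P)"
proof -
  note b = bp[unfolded is_biproduct_def]
  have "(u, v) \<in> (\<lambda>w. (p \<cdot> w, q \<cdot> w)) ` Hom \<A> W P" if uv: "u \<in> Hom \<A> W X" "v \<in> Hom \<A> W Y" for u v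
  proof -
    have "p \<cdot> (i \<cdot> u) = u" "p \<cdot> (j \<cdot> v) = hzero \<A> W X" "q \<cdot> (i \<cdot> u) = hzero \<A> W Y" "q \<cdot> (j \<cdot> v) = v"
      using cmp_cmp_eq[of p i "ide \<A> X" u] cmp_cmp_eq[of p j "hzero \<A> Y X" v]
        cmp_cmp_eq[of q i "hzero \<A> X Y" u] cmp_cmp_eq[of q j "ide \<A> Y" v] b uv
      by (simp_all add: additive_simps)
    then show ?thesis
      using b uv W by (intro image_eqI[of _ _ "(i \<cdot> u) \<boxplus> (j \<cdot> v)"]) (simp_all add: additive_simps)
  qed
  then have "Hom \<A> W X \<times> Hom \<A> W Y \<subseteq> (\<lambda>w. (p \<cdot> w, q \<cdot> w)) ` Hom \<A> W P" by auto
  from surj_card_le[OF fin this] show ?thesis by (simp add: card_cartesian_product)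
qed

end

text \<open>\<open>S\<close> is the disjoint union of the fibres of \<open>r\<close> over its
  image.\<close>

lemma card_le_card_image_mult_fibre:
  assumes "finite S" and "\<And>s. s \<in> S \<Longrightarrow> card {s' \<in> S. r s' = r s} \<le> m"
  shows "card S \<le> card (r ` S) * m"
proof -
  have "card S = (\<Sum>t \<in> r ` S. card {s' \<in> S. r s' = t})"
    using sum.image_gen[OF assms(1), of "\<lambda>_. 1::nat" r] by simp
  also have "\<dots> \<le> (\<Sum>t \<in> r ` S. m)"
    using assms(2) by (intro sum_mono) auto
  finally show ?thesis by simp
qed

section \<open>Factorisation through conflations and their splitting\<close>

context exact_category
begin

lemma conflation_cokernel_factor:
  assumes "(f, g) \<in> conflations \<A>" "f \<in> Hom \<A> B X" "g \<in> Hom \<A> X A"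
    and h: "h \<in> Hom \<A> X W" "h \<cdot> f = hzero \<A> B W"
  shows "\<exists>!u. u \<in> Hom \<A> A W \<and> u \<cdot> g = h"
proof -
  have "W \<in> Ob \<A>" using h Hom_Ob by blast
  then show ?thesis
    using conflation_cokernel[OF assms(1)] assms(2-) by (simp add: is_cokernel_def Hom_iff)
qed

lemma conflation_kernel_factor:
  assumes "(f, g) \<in> conflations \<A>" "f \<in> Hom \<A> B X" "g \<in> Hom \<A> X A"
    and h: "h \<in> Hom \<A> W X" "g \<cdot> h = hzero \<A> W A"
  shows "\<exists>!u. u \<in> Hom \<A> W B \<and> f \<cdot> u = h"
proof -
  have "W \<in> Ob \<A>" using h Hom_Ob by blast
  then show ?thesis
    using conflation_kernel[OF assms(1)] assms(2-) by (simp add: is_kernel_def Hom_iff)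
qed

text \<open>The splitting lemma: the complement of the idempotent \<open>f \<cdot> r\<close> factors
  through \<open>g\<close>, which produces a section \<open>s\<close> of \<open>g\<close>.\<close>

lemma retraction_biproduct:
  assumes conf: "(f, g) \<in> conflations \<A>" and fg: "f \<in> Hom \<A> B X" "g \<in> Hom \<A> X A"
    and r: "r \<in> Hom \<A> X B" "r \<cdot> f = ide \<A> B"
  shows "\<exists>i j p q. is_biproduct \<A> B A X i j p q"
proof -
  have Ob: "X \<in> Ob \<A>" "A \<in> Ob \<A>" "B \<in> Ob \<A>" using fg Hom_Ob by blast+
  have gf: "g \<cdot> f = hzero \<A> B A" using conflation_cokernel[OF conf] fg by (simp add: is_cokernel_def Hom_iff)
  note factor = conflation_cokernel_factor[OF conf fg]
  \<comment> \<open>Uniqueness in the cokernel property, applied to \<open>v \<cdot> g\<close>,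
    makes \<open>g\<close> an epimorphism.\<close>
  have epi: "u = v" if "u \<in> Hom \<A> A W" "v \<in> Hom \<A> A W" "u \<cdot> g = v \<cdot> g" for u v W
  proof -
    have W: "W \<in> Ob \<A>" using that Hom_Ob by blast
    have "v \<cdot> g \<in> Hom \<A> X W" "(v \<cdot> g) \<cdot> f = hzero \<A> B W"
      using that fg gf W Ob by (auto simp: additive_simps)
    from factor[OF this] that show ?thesis by blast
  qed
  \<comment> \<open>\<open>d\<close> is the identity minus \<open>f \<cdot> r\<close>. It vanishes
    on \<open>f\<close> and so descends to \<open>s\<close>.\<close>
  obtain d where d: "d \<in> Hom \<A> X X" "(f \<cdot> r) \<boxplus> d = ide \<A> X"
    using hadd_diff_exists[of "f \<cdot> r" X X "ide \<A> X"] fg r Ob by (auto simp: additive_simps)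
  have "((f \<cdot> r) \<boxplus> d) \<cdot> f = f" using d fg ide_cmp by simp
  then have "d \<cdot> f = hzero \<A> B X"
    using d(1) fg r by (intro hadd_right_eq_self[of f]) (auto simp: additive_simps)
  then obtain s where s: "s \<in> Hom \<A> A X" "s \<cdot> g = d" using factor[OF d(1)] by blast
  have "g \<cdot> ((f \<cdot> r) \<boxplus> d) = g" using d fg cmp_ide by simp
  moreover have "g \<cdot> (f \<cdot> r) = hzero \<A> X A"
    using cmp_cmp_eq[OF gf, of r] fg r Ob by (simp add: additive_simps)
  ultimately have "g \<cdot> d = g" using d(1) fg r by (simp add: additive_simps)
  then have "(g \<cdot> s) \<cdot> g = ide \<A> A \<cdot> g" using fg s by (simp add: category_simps)
  then have gs: "g \<cdot> s = ide \<A> A"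
    by (rule epi[rotated 2]) (use fg s Ob in \<open>simp_all add: category_simps\<close>)
  \<comment> \<open>Since \<open>r\<close> kills \<open>d\<close>, cancelling \<open>g\<close> shows
    that \<open>r\<close> kills \<open>s\<close>.\<close>
  have "r \<cdot> ((f \<cdot> r) \<boxplus> d) = r" using d r cmp_ide by simp
  moreover have "r \<cdot> (f \<cdot> r) = r"
    using cmp_cmp_eq[OF r(2), of r] fg r Ob by (simp add: additive_simps)
  ultimately have "r \<cdot> d = hzero \<A> X B"
    using d(1) fg r(1) by (intro hadd_right_eq_self[of r]) (auto simp: additive_simps)
  then have "(r \<cdot> s) \<cdot> g = hzero \<A> A B \<cdot> g" using fg s r(1) Ob by (simp add: additive_simps)
  then have rs: "r \<cdot> s = hzero \<A> A B"
    by (rule epi[rotated 2]) (use fg s r(1) Ob in \<open>simp_all add: additive_simps\<close>)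
  have "is_biproduct \<A> B A X f s r g"
    unfolding is_biproduct_def using Ob fg r s d gs rs gf by simp
  then show ?thesis by blast
qed

end

section \<open>Sizes of Hom sets along a conflation, and split conflations\<close>

context finitary_exact_category
begin

text \<open>Left exactness of Hom(-, W): maps with equal restriction along \<open>f\<close> differ
  by a map through \<open>g\<close>, which bounds each fibre of restriction by |Hom(A, W)|. The
  image is kept as a factor because the strict inequality is gained there for W = B.\<close>

lemma card_Hom_from_middle_le:
  assumes conf: "(f, g) \<in> conflations \<A>" and fg: "f \<in> Hom \<A> B X" "g \<in> Hom \<A> X A" and W: "W \<in> Ob \<A>"
  shows "card (Hom \<A> X W) \<le> card ((\<lambda>u. u \<cdot> f) ` Hom \<A> X W) * card (Hom \<A> A W)"
proof (rule card_le_card_image_mult_fibre)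
  have Ob: "X \<in> Ob \<A>" "A \<in> Ob \<A>" "B \<in> Ob \<A>" using fg Hom_Ob by blast+
  show "finite (Hom \<A> X W)" using Ob W finite_Hom by blast
  fix u assume u: "u \<in> Hom \<A> X W"
  have "{u' \<in> Hom \<A> X W. u' \<cdot> f = u \<cdot> f} \<subseteq> (\<lambda>v. u \<boxplus> (v \<cdot> g)) ` Hom \<A> A W"
  proof clarify
    fix u' assume u': "u' \<in> Hom \<A> X W" "u' \<cdot> f = u \<cdot> f"
    obtain d where d: "d \<in> Hom \<A> X W" "u \<boxplus> d = u'" using hadd_diff_exists[OF u u'(1)] .
    have "(u \<boxplus> d) \<cdot> f = u \<cdot> f" using d u' by simp
    then have "d \<cdot> f = hzero \<A> B W"
      using d(1) u fg by (intro hadd_right_eq_self[of "u \<cdot> f"]) (auto simp: additive_simps)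
    then obtain v where "v \<in> Hom \<A> A W" "v \<cdot> g = d"
      using conflation_cokernel_factor[OF conf fg d(1)] by blast
    then show "u' \<in> (\<lambda>v. u \<boxplus> (v \<cdot> g)) ` Hom \<A> A W" using d(2) by blast
  qed
  then show "card {u' \<in> Hom \<A> X W. u' \<cdot> f = u \<cdot> f} \<le> card (Hom \<A> A W)"
    using Ob W by (intro surj_card_le finite_Hom)
qed

text \<open>The dual argument with Hom(W, -) and the kernel property; here the image is simply
  bounded by all of Hom(W, A).\<close>

lemma card_Hom_to_middle_le:
  assumes conf: "(f, g) \<in> conflations \<A>" and fg: "f \<in> Hom \<A> B X" "g \<in> Hom \<A> X A" and W: "W \<in> Ob \<A>"
  shows "card (Hom \<A> W X) \<le> card (Hom \<A> W A) * card (Hom \<A> W B)"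
proof -
  have Ob: "X \<in> Ob \<A>" "A \<in> Ob \<A>" "B \<in> Ob \<A>" using fg Hom_Ob by blast+
  have "card (Hom \<A> W X) \<le> card ((\<lambda>u. g \<cdot> u) ` Hom \<A> W X) * card (Hom \<A> W B)"
  proof (rule card_le_card_image_mult_fibre)
    show "finite (Hom \<A> W X)" using Ob W finite_Hom by blast
    fix u assume u: "u \<in> Hom \<A> W X"
    have "{u' \<in> Hom \<A> W X. g \<cdot> u' = g \<cdot> u} \<subseteq> (\<lambda>v. u \<boxplus> (f \<cdot> v)) ` Hom \<A> W B"
    proof clarify
      fix u' assume u': "u' \<in> Hom \<A> W X" "g \<cdot> u' = g \<cdot> u"
      obtain d where d: "d \<in> Hom \<A> W X" "u \<boxplus> d = u'" using hadd_diff_exists[OF u u'(1)] .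
      have "g \<cdot> (u \<boxplus> d) = g \<cdot> u" using d u' by simp
      then have "g \<cdot> d = hzero \<A> W A"
        using d(1) u fg by (intro hadd_right_eq_self[of "g \<cdot> u"]) (auto simp: additive_simps)
      then obtain v where "v \<in> Hom \<A> W B" "f \<cdot> v = d"
        using conflation_kernel_factor[OF conf fg d(1)] by blast
      then show "u' \<in> (\<lambda>v. u \<boxplus> (f \<cdot> v)) ` Hom \<A> W B" using d(2) by blast
    qed
    then show "card {u' \<in> Hom \<A> W X. g \<cdot> u' = g \<cdot> u} \<le> card (Hom \<A> W B)"
      using Ob W by (intro surj_card_le finite_Hom)
  qed
  moreover have "card ((\<lambda>u. g \<cdot> u) ` Hom \<A> W X) \<le> card (Hom \<A> W A)"
    using finite_Hom Ob W fg cmp_Hom by (intro card_mono) auto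
  ultimately show ?thesis by (meson le_trans mult_le_mono1)
qed

lemma card_Hom_pos: "X \<in> Ob \<A> \<Longrightarrow> Y \<in> Ob \<A> \<Longrightarrow> 0 < card (Hom \<A> X Y)"
  using finite_Hom[of X Y] Ar_hzero[of X Y] by (auto simp: card_gt_0_iff Hom_iff)

text \<open>The four factors count the entries of the 2 by 2 matrices that describe endomorphisms of
  \<open>P\<close>; the target is split first, then the source of each component.\<close>

lemma card_End_biproduct_ge:
  assumes bp: "is_biproduct \<A> B A P i j p q"
  shows "(card (Hom \<A> B B) * card (Hom \<A> A B)) * (card (Hom \<A> B A) * card (Hom \<A> A A))
    \<le> card (Hom \<A> P P)"
proof -
  have Ob: "B \<in> Ob \<A>" "A \<in> Ob \<A>" "P \<in> Ob \<A>" using bp by (auto simp: is_biproduct_def)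
  show ?thesis
    using card_Hom_from_biproduct[OF bp finite_Hom, of B]
      card_Hom_from_biproduct[OF bp finite_Hom, of A]
      card_Hom_to_biproduct[OF bp finite_Hom, of P] Ob
    by (meson le_trans mult_le_mono)
qed

lemma card_End_middle_less:
  assumes conf: "(f, g) \<in> conflations \<A>" and fg: "f \<in> Hom \<A> B X" "g \<in> Hom \<A> X A"
    and bp: "is_biproduct \<A> B A P i j p q" and ne: "iso_class \<A> X \<noteq> iso_class \<A> P"
  shows "card (Hom \<A> X X) < card (Hom \<A> P P)"
proof -
  have Ob: "X \<in> Ob \<A>" "A \<in> Ob \<A>" "B \<in> Ob \<A>" using fg Hom_Ob by blast+
  \<comment> \<open>The maps \<open>B \<rightarrow> W\<close> that extend along
    \<open>f\<close>.\<close>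
  let ?R = "\<lambda>W. (\<lambda>u. u \<cdot> f) ` Hom \<A> X W"
  have sub: "?R W \<subseteq> Hom \<A> B W" for W using fg cmp_Hom by blast
  \<comment> \<open>An extension of the identity would be a retraction of \<open>f\<close>, so
    \<open>X\<close> would be a biproduct of \<open>B\<close> and \<open>A\<close>, hence isomorphic
    to \<open>P\<close>, against \<open>ne\<close>.\<close>
  have "ide \<A> B \<notin> ?R B"
    using retraction_biproduct[OF conf fg] biproduct_unique[OF _ bp] iso_class_eq ne by fastforce
  then have less: "card (?R B) < card (Hom \<A> B B)"
    using sub[of B] finite_Hom Ob ide_Hom by (intro psubset_card_mono) auto
  have "card (Hom \<A> X X) \<le> card (Hom \<A> X A) * card (Hom \<A> X B)"
    using card_Hom_to_middle_le[OF conf fg] Ob by blast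
  also have "\<dots> \<le> (card (?R A) * card (Hom \<A> A A)) * (card (?R B) * card (Hom \<A> A B))"
    using card_Hom_from_middle_le[OF conf fg] Ob by (intro mult_le_mono) auto
  also have "\<dots> \<le> (card (Hom \<A> B A) * card (Hom \<A> A A)) * (card (?R B) * card (Hom \<A> A B))"
    using sub finite_Hom Ob by (intro mult_le_mono card_mono) auto
  also have "\<dots> < (card (Hom \<A> B A) * card (Hom \<A> A A)) * (card (Hom \<A> B B) * card (Hom \<A> A B))"
    using less card_Hom_pos Ob by simp
  also have "\<dots> = (card (Hom \<A> B B) * card (Hom \<A> A B)) * (card (Hom \<A> B A) * card (Hom \<A> A A))"
    by (simp add: ac_simps)
  also have "\<dots> \<le> card (Hom \<A> P P)" by (rule card_End_biproduct_ge[OF bp])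
  finally show ?thesis .
qed

text \<open>As \<open>A\<close> is nonzero, its identity differs from its zero endomorphism, so |End
  A| is at least 2; the two mixed factors in \<open>card_End_biproduct_ge\<close> are at least
  1.\<close>

lemma card_End_summand_less:
  assumes bp: "is_biproduct \<A> B A P i j p q" and "\<not> zero_object \<A> A"
  shows "card (Hom \<A> B B) < card (Hom \<A> P P)"
proof -
  have Ob: "B \<in> Ob \<A>" "A \<in> Ob \<A>" using bp by (auto simp: is_biproduct_def)
  have "ide \<A> A \<noteq> hzero \<A> A A" using assms Ob zero_object_if_ide_eq_hzero by blast
  then have "card {ide \<A> A, hzero \<A> A A} = 2" by simp
  moreover have "card {ide \<A> A, hzero \<A> A A} \<le> card (Hom \<A> A A)"
    using finite_Hom Ob by (intro card_mono) (auto simp: additive_simps)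
  ultimately have "1 < card (Hom \<A> A A)" by simp
  also have "\<dots> \<le> card (Hom \<A> A B) * card (Hom \<A> B A) * card (Hom \<A> A A)"
    using card_Hom_pos Ob by (simp add: Suc_le_eq)
  finally have "card (Hom \<A> B B) * 1 <
      card (Hom \<A> B B) * (card (Hom \<A> A B) * card (Hom \<A> B A) * card (Hom \<A> A A))"
    using card_Hom_pos Ob by (intro mult_strict_left_mono) auto
  also have "\<dots> = (card (Hom \<A> B B) * card (Hom \<A> A B)) * (card (Hom \<A> B A) * card (Hom \<A> A A))"
    by (simp add: ac_simps)
  also have "\<dots> \<le> card (Hom \<A> P P)" by (rule card_End_biproduct_ge[OF bp])
  finally show ?thesis by simp
qed

lemma iso_class_in_Ext1:
  assumes "is_biproduct \<A> B A P i j p q"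
  shows "iso_class \<A> P \<in> Ext1 \<A> A B"
  using assms conflation_split[OF assms] unfolding Ext1_def ses_def is_biproduct_def by blast

text \<open>The split conflation \<open>(i, q)\<close> is counted in the numerator.\<close>

lemma hall_number_biproduct_neq_0:
  assumes bp: "is_biproduct \<A> B A P i j p q"
  shows "hall_number \<A> A B P \<noteq> 0"
proof -
  have Ob: "B \<in> Ob \<A>" "A \<in> Ob \<A>" "P \<in> Ob \<A>" using bp by (auto simp: is_biproduct_def)
  have "ses \<A> A B P \<subseteq> Hom \<A> B P \<times> Hom \<A> P A" by (auto simp: ses_def)
  then have "finite (ses \<A> A B P)" 
    by (rule finite_subset) (simp add: finite_Hom Ob)
  moreover have "(i, q) \<in> ses \<A> A B P"
    using bp conflation_split[OF bp] by (auto simp: ses_def is_biproduct_def)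
  \<comment> \<open>Division by zero gives zero and \<open>card\<close> is zero on infinite sets, so
    the denominator must be shown to be nonzero too.\<close>
  moreover have "finite (Aut \<A> Z) \<and> Aut \<A> Z \<noteq> {}" if "Z \<in> Ob \<A>" for Z
    using that finite_Hom[of Z Z] ide_Isos[of Z] by (auto simp: Aut_def Isos_def)
  ultimately show ?thesis using Ob by (auto simp: hall_number_def)
qed

end

section \<open>Scalars, basis products and sums in the Hall algebra\<close>

lemma lookup_hall_scale: "Poly_Mapping.lookup (hall_scale r u) c = r * Poly_Mapping.lookup u c"
  by (simp add: hall_scale_def Poly_Mapping.map.rep_eq when_def)

lemma hall_scale_single: "hall_scale r (Poly_Mapping.single c s) = Poly_Mapping.single c (r * s)"
  by (rule poly_mapping_eqI) (simp add: lookup_hall_scale lookup_single when_def)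

text \<open>Each term is left as a scalar multiple of a basis vector, the form to which closure of a
  subalgebra under \<open>hall_scale\<close> applies.\<close>

lemma poly_mapping_sum_hall_scale:
  "u = (\<Sum>c \<in> Poly_Mapping.keys u. hall_scale (Poly_Mapping.lookup u c) (Poly_Mapping.single c 1))"
  unfolding hall_scale_single
  by (rule poly_mapping_eqI) (simp add: lookup_sum lookup_single when_def in_keys_iff)

text \<open>Both factors have singleton support with coefficient 1, so the double sum has a single
  term.\<close>

lemma hall_mult_hall_basis:
  "hall_mult \<A> (hall_basis \<A> X) (hall_basis \<A> Y) =
     hall_basis_mult \<A> (class_rep (iso_class \<A> X)) (class_rep (iso_class \<A> Y))"
  by (rule poly_mapping_eqI) (simp add: hall_mult_def hall_basis_def lookup_hall_scale)

lemma hall_subalgebra_sum: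
  assumes "hall_subalgebra \<A> T" "\<And>x. x \<in> S \<Longrightarrow> f x \<in> T"
  shows "sum f S \<in> T"
  using assms by (induction S rule: infinite_finite_induct) (auto simp: hall_subalgebra_def)

section \<open>Generation of the Hall algebra by indecomposable classes\<close>

context finitary_exact_category
begin

text \<open>The hull is the intersection of the subalgebras containing the generators; having the
  whole space among them bounds it from above.\<close>

lemma hall_subalgebra_hall_space: "hall_subalgebra \<A> (hall_space \<A>)"
proof -
  have add: "u + v \<in> hall_space \<A>" if "u \<in> hall_space \<A>" "v \<in> hall_space \<A>" for u v
    using that Poly_Mapping.keys_add[of u v] by (auto simp: hall_space_def)
  have scale: "hall_scale r u \<in> hall_space \<A>" if "u \<in> hall_space \<A>" for r u
    using that by (auto simp: hall_space_def in_keys_iff lookup_hall_scale)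
  have zero: "0 \<in> hall_space \<A>" by (simp add: hall_space_def)
  have sum: "sum f S \<in> hall_space \<A>" if "\<And>x. x \<in> S \<Longrightarrow> f x \<in> hall_space \<A>"
    for f :: "'x \<Rightarrow> 'a set \<Rightarrow>\<^sub>0 rat" and S
    using that by (induction S rule: infinite_finite_induct) (auto simp: add zero)
  have single: "Poly_Mapping.single c r \<in> hall_space \<A>" if "c \<in> iso_classes \<A>" for c r
    using that by (auto simp: hall_space_def)
  have "(SOME Z. zero_object \<A> Z) \<in> Ob \<A>"
    using someI_ex[OF zero_object_exists] by (simp add: zero_object_def[of \<A> "SOME Z. zero_object \<A> Z"])
  then have one: "hall_one \<A> \<in> hall_space \<A>"
    unfolding hall_one_def hall_basis_def
    by (intro single) (simp add: iso_classes_def)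
  \<comment> \<open>This holds for arbitrary \<open>X\<close> and \<open>Y\<close>, since by
    definition \<open>Ext1\<close> consists of classes of objects.\<close>
  have "hall_basis_mult \<A> X Y \<in> hall_space \<A>" for X Y
    unfolding hall_basis_mult_def by (intro sum single) (auto simp: Ext1_def iso_classes_def)
  then have "hall_mult \<A> u v \<in> hall_space \<A>" for u v
    unfolding hall_mult_def by (intro sum scale)
  then show ?thesis
    using add scale one by (auto simp: hall_subalgebra_def hall_space_def)
qed

lemma hall_basis_in_subalgebra:
  assumes T: "hall_subalgebra \<A> T" and ind: "\<And>X. indecomposable \<A> X \<Longrightarrow> hall_basis \<A> X \<in> T"
    and "X \<in> Ob \<A>"
  shows "hall_basis \<A> X \<in> T"
  using assms(3)
proof (induction "card (Hom \<A> X X)" arbitrary: X rule: less_induct)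
  case less
  have smaller: "hall_basis \<A> Y \<in> T" if "Y \<in> Ob \<A>" "card (Hom \<A> Y Y) < card (Hom \<A> X X)" for Y
    using less that by blast
  \<comment> \<open>An object that is neither zero nor indecomposable has a decomposition into two
    nonzero summands.\<close>
  consider "zero_object \<A> X" | "indecomposable \<A> X"
    | B A i j p q where "is_biproduct \<A> B A X i j p q" "\<not> zero_object \<A> A" "\<not> zero_object \<A> B"
    using less.prems unfolding indecomposable_def by blast
  then show ?case
  proof cases
    case 1
    \<comment> \<open>The unit is the class of a chosen zero object, and all zero objects are
      isomorphic.\<close>
    moreover have "zero_object \<A> (SOME Z. zero_object \<A> Z)" using zero_object_exists by (rule someI_ex)
    ultimately have "hall_basis \<A> X = hall_one \<A>"
      unfolding hall_one_def hall_basis_def using zero_objects_iso iso_class_eq by metis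
    then show ?thesis using T by (simp add: hall_subalgebra_def)
  next
    case 2
    then show ?thesis by (rule ind)
  next
    case (3 B A i j p q)
    \<comment> \<open>The product of [A] and [B] is computed at these representatives, so the
      decomposition of \<open>X\<close> is moved to them.\<close>
    define A' where "A' = class_rep (iso_class \<A> A)"
    define B' where "B' = class_rep (iso_class \<A> B)"
    have Ob: "A \<in> Ob \<A>" "B \<in> Ob \<A>" using 3 by (auto simp: is_biproduct_def)
    have isos: "Isos \<A> A A' \<noteq> {}" "Isos \<A> B B' \<noteq> {}"
      using class_rep_iso_class Ob by (auto simp: A'_def B'_def)
    obtain i' j' p' q' where bp: "is_biproduct \<A> B' A' X i' j' p' q'"
      using biproduct_iso[OF 3(1) isos(2,1)] ide_Isos[OF less.prems] by blast
    have Ob': "A' \<in> Ob \<A>" "B' \<in> Ob \<A>" using bp by (auto simp: is_biproduct_def)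
    let ?E = "Ext1 \<A> A' B'"
    let ?F = "\<lambda>c. hall_number \<A> A' B' (class_rep c)"
    let ?x = "iso_class \<A> X"
    \<comment> \<open>All terms of the product other than the multiple of [X].\<close>
    define S where "S = (\<Sum>c \<in> ?E - {?x}. Poly_Mapping.single c (?F c))"
    have "hall_basis \<A> A \<in> T" "hall_basis \<A> B \<in> T"
      using smaller Ob card_End_summand_less[OF 3(1)] card_End_summand_less[OF biproduct_sym[OF 3(1)]] 3
      by blast+
    then have "hall_mult \<A> (hall_basis \<A> A) (hall_basis \<A> B) \<in> T"
      using T by (simp add: hall_subalgebra_def)
    moreover have "hall_mult \<A> (hall_basis \<A> A) (hall_basis \<A> B) = Poly_Mapping.single ?x (?F ?x) + S"
      unfolding hall_mult_hall_basis A'_def[symmetric] B'_def[symmetric] hall_basis_mult_def S_def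
      using finite_Ext1 Ob' iso_class_in_Ext1[OF bp] by (intro sum.remove)
    ultimately have prod: "Poly_Mapping.single ?x (?F ?x) + S \<in> T" by simp
    have "Poly_Mapping.single c (?F c) \<in> T" if c: "c \<in> ?E - {?x}" for c
    proof -
      obtain C f g where C: "c = iso_class \<A> C" "(f, g) \<in> conflations \<A>" "f \<in> Hom \<A> B' C" "g \<in> Hom \<A> C A'"
        "C \<in> Ob \<A>"
        using c by (auto simp: Ext1_def ses_def)
      \<comment> \<open>\<open>C\<close> is the middle term of a conflation with ends
        \<open>B'\<close> and \<open>A'\<close> and is not isomorphic to \<open>X\<close>; it has
        fewer endomorphisms, and the induction hypothesis applies.\<close>
      then have "hall_basis \<A> C \<in> T"
        using smaller card_End_middle_less[OF C(2-4) bp] c by blast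
      then have "hall_scale (?F c) (hall_basis \<A> C) \<in> T" using T by (simp add: hall_subalgebra_def)
      then show ?thesis by (simp add: hall_basis_def C(1) hall_scale_single)
    qed
    then have "S \<in> T" unfolding S_def by (rule hall_subalgebra_sum[OF T])
    \<comment> \<open>Adding the multiple of \<open>S\<close> by -1 plays the role of
      subtraction.\<close>
    then have "Poly_Mapping.single ?x (?F ?x) + S + hall_scale (- 1) S \<in> T"
      using prod T by (simp add: hall_subalgebra_def)
    moreover have "S + hall_scale (- 1) S = 0"
      by (rule poly_mapping_eqI) (simp add: lookup_add lookup_hall_scale)
    ultimately have "Poly_Mapping.single ?x (?F ?x) \<in> T" by (simp add: add.assoc)
    then have "hall_scale (1 / ?F ?x) (Poly_Mapping.single ?x (?F ?x)) \<in> T"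
      using T by (simp add: hall_subalgebra_def)
    \<comment> \<open>The coefficient is evaluated at the representative of [X], so a split
      conflation with that middle term is required.\<close>
    moreover obtain i2 j2 p2 q2 where "is_biproduct \<A> B' A' (class_rep ?x) i2 j2 p2 q2"
      using biproduct_iso[OF bp] ide_Isos Ob' class_rep_iso_class(2)[OF less.prems] by blast
    then have "?F ?x \<noteq> 0" by (rule hall_number_biproduct_neq_0)
    ultimately show ?thesis by (simp add: hall_scale_single hall_basis_def)
  qed
qed

end

theorem theorem1p1:
  fixes \<A> :: "('o, 'm, 'z) ex_cat_scheme"
  assumes "finitary_exact_category \<A>"
  shows "(hall_subalgebra \<A>) hull {hall_basis \<A> X | X. indecomposable \<A> X} = hall_space \<A>"
proof
  interpret finitary_exact_category \<A> by (rule assms)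
  show "(hall_subalgebra \<A>) hull {hall_basis \<A> X | X. indecomposable \<A> X} \<subseteq> hall_space \<A>"
    using hall_subalgebra_hall_space
    by (intro hull_minimal) (auto simp: hall_space_def hall_basis_def iso_classes_def indecomposable_def)
  show "hall_space \<A> \<subseteq> (hall_subalgebra \<A>) hull {hall_basis \<A> X | X. indecomposable \<A> X}"
  proof
    fix u assume u: "u \<in> hall_space \<A>"
    \<comment> \<open>Membership in the hull is tested in each subalgebra containing the generators,
      by expanding \<open>u\<close> in the basis.\<close>
    have "u \<in> T" if T: "hall_subalgebra \<A> T" "{hall_basis \<A> X | X. indecomposable \<A> X} \<subseteq> T" for T
    proof -
      have "hall_scale (Poly_Mapping.lookup u c) (Poly_Mapping.single c 1) \<in> T"
        if c: "c \<in> Poly_Mapping.keys u" for c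
      proof -
        obtain X where "X \<in> Ob \<A>" "c = iso_class \<A> X"
          using u c unfolding hall_space_def iso_classes_def by blast
        then have "Poly_Mapping.single c 1 \<in> T"
          using hall_basis_in_subalgebra[OF T(1)] T(2) by (auto simp: hall_basis_def)
        then show ?thesis using T(1) by (simp add: hall_subalgebra_def)
      qed
      then have "(\<Sum>c \<in> Poly_Mapping.keys u. hall_scale (Poly_Mapping.lookup u c) (Poly_Mapping.single c 1)) \<in> T"
        by (rule hall_subalgebra_sum[OF T(1)])
      then show ?thesis by (simp only: poly_mapping_sum_hall_scale[of u, symmetric])
    qed
    then show "u \<in> (hall_subalgebra \<A>) hull {hall_basis \<A> X | X. indecomposable \<A> X}"
      by (auto simp: hull_def)
  qed
qed

end
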